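(* For a (Hausdorff) topological space $X$ the following conditions are equivalent: (1) $X$ is $k^*$-metrizable; (2) $X$ is $\mathrm{cs}^*$-metrizable and all compact subsets of $X$ are sequentially compact; (3) the map $\lim:\mathrm{Nw}(X)\to X$ has a section that preserves precompact sets; (4) all compact subsets of $X$ are sequentially compact and $X$ has a $\sigma$-cs-finite $\mathrm{cl}_1$-osed $\mathrm{cs}^*$-network; (5) $X$ has a $\sigma$-compact-finite $\mathrm{cl}_1$-osed $k$-network. If the space $X$ is sequentially regular, then the conditions (1)--(5) are equivalent to (6) $X$ has a $\sigma$-compact-finite $k$-network.
   Context: All topological spaces are Hausdorff; "map" means continuous function. A subset is precompact if its closure is compact. A section of a map $f:X\to Y$ is a (possibly discontinuous) function $s:Y\to X$ with $f\circ s=\mathrm{id}_Y$. A function preserves precompact sets if it sends precompact sets to precompact sets. A map $f:X\to Y$ is subproper if there is $Z\subset X$ with $f(Z)=Y$ such that $Z\cap f^{-1}(K)$ is precompact in $X$ for every precompact $K\subset Y$. A space is $k^*$-metrizable if it is the image of a metrizable space under a subproper map. A function $s:Y\to X$ is $\mathrm{cs}^*$-continuous if for every convergent sequence $(y_n)$ in $Y$ the sequence $(s(y_n))$ has an accumulation point in $X$ (a point each of whose neighborhoods contains $s(y_n)$ for infinitely many $n$). A space $X$ is $\mathrm{cs}^*$-metrizable if it is the image of a metrizable space $M$ under a map $\pi:M\to X$ having a $\mathrm{cs}^*$-continuous section. A space is sequentially compact if each sequence in it contains a convergent subsequence. For $A\subset X$, $\mathrm{cl}_1(A)$ denotes the set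 of limits of all sequences $(a_n)\subset A$ that converge in $X$. $X$ is sequentially regular if for each point $x\in X$ and neighborhood $U$ of $x$ there is a neighborhood $V$ of $x$ with $\mathrm{cl}_1(V)\subset U$. Network Hyperspace: let $\mathcal P(X)$ be the power-set of $X$ with the discrete topology. For $x\in X$ let $\mathrm{Nw}(x)\subset\mathcal P(X)^\omega$ be the set of all sequences $(A_n)_{n\in\omega}$ of non-empty subsets of $X$ such that $A_{n+1}\subset A_n$ for all $n$ and for every neighborhood $U$ of $x$ there is $n$ with $\mathrm{cl}_1(A_n)\subset U$. Put $\mathrm{Nw}(X)=\bigcup_{x\in X}\mathrm{Nw}(x)$ with the subspace topology from the Tychonoff product $\mathcal P(X)^\omega$. Since $X$ is Hausdorff, the sets $\mathrm{Nw}(x)$ are pairwise disjoint, and $\lim:\mathrm{Nw}(X)\to X$ is the (continuous) map with $\lim^{-1}(x)=\mathrm{Nw}(x)$. A family $\mathcal N$ of subsets of $X$ is a $k$-network (resp. $\mathrm{cl}_1$-osed $k$-network) for $X$ if for every open $U\subset X$ and compact $K\subset U$ there is a finite $\mathcal F\subset\mathcal N$ with $K\subset\bigcup\mathcal F\subset U$ (resp. $K\subset\bigcup\mathcal F\subset\mathrm{cl}_1(\bigcup\mathcal F)\subset U$). $\mathcal N$ is a $\mathrm{cl}_1$-osed $\mathrm{cs}^*$-network if for every open $U\subset X$ and sequence $(x_n)\subset U$ convergent to a point of $U$ there is $N\in\mathcal N$ with $x_n\in N$ for infinitely many $n$ and $\mathrm{cl}_1(N)\subset U$. A family $\mathcal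 A$ is compact-finite (resp. cs-finite) if every compact subset (resp. convergent sequence) $K\subset X$ meets only finitely many sets $A\in\mathcal A$; it is $\sigma$-compact-finite (resp. $\sigma$-cs-finite) if it is a countable union of compact-finite (resp. cs-finite) subfamilies. *)

theory Defs
  imports "HOL-Analysis.Analysis"
begin

section \<open>Precompact sets, sections, subproper maps\<close>

definition precompactin :: "'a topology \<Rightarrow> 'a set \<Rightarrow> bool" where
  "precompactin X A \<longleftrightarrow> A \<subseteq> topspace X \<and> compactin X (X closure_of A)"

text \<open>Unlike the library's \<open>section_map\<close>, a section here need not be continuous.\<close>

definition section_of :: "'a topology \<Rightarrow> 'b topology \<Rightarrow> ('a \<Rightarrow> 'b) \<Rightarrow> ('b \<Rightarrow> 'a) \<Rightarrow> bool" where
  "section_of X Y f s \<longleftrightarrow>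
     s \<in> topspace Y \<rightarrow> topspace X \<and> (\<forall>y\<in>topspace Y. f (s y) = y)"

definition preserves_precompact :: "'a topology \<Rightarrow> 'b topology \<Rightarrow> ('a \<Rightarrow> 'b) \<Rightarrow> bool" where
  "preserves_precompact X Y f \<longleftrightarrow> (\<forall>K. precompactin X K \<longrightarrow> precompactin Y (f ` K))"

definition subproper_map :: "'a topology \<Rightarrow> 'b topology \<Rightarrow> ('a \<Rightarrow> 'b) \<Rightarrow> bool" where
  "subproper_map X Y f \<longleftrightarrow> continuous_map X Y f \<and>
     (\<exists>Z. Z \<subseteq> topspace X \<and> f ` Z = topspace Y \<and>
          (\<forall>K. precompactin Y K \<longrightarrow> precompactin X (Z \<inter> f -` K)))"

definition cs_star_continuous :: "'a topology \<Rightarrow> 'b topology \<Rightarrow> ('a \<Rightarrow> 'b) \<Rightarrow> bool" where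
  "cs_star_continuous Y X s \<longleftrightarrow> s \<in> topspace Y \<rightarrow> topspace X \<and>
     (\<forall>y l. range y \<subseteq> topspace Y \<and> limitin Y y l sequentially \<longrightarrow>
        (\<exists>x\<in>topspace X. \<forall>U. openin X U \<and> x \<in> U \<longrightarrow> infinite {n. s (y n) \<in> U}))"

section \<open>The two classes of spaces\<close>

text \<open>
  Being the image of a metrizable space quantifies over all metrizable spaces, whereas a HOL
  formula can only quantify over the spaces carried by one type. In both definitions the
  metrizable space is taken on the type \<open>nat \<Rightarrow> 'a set\<close>. This is no restriction: by the theorems
  \<open>k_star_metrizableI\<close> and \<open>cs_star_metrizableI\<close> below, a witness on an arbitrary type
  can always be replaced by one on this type.
\<close>

definition k_star_metrizable :: "'a topology \<Rightarrow> bool" where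
  "k_star_metrizable X \<longleftrightarrow>
     (\<exists>(M :: (nat \<Rightarrow> 'a set) topology) f. metrizable_space M \<and> subproper_map M X f)"

definition cs_star_metrizable :: "'a topology \<Rightarrow> bool" where
  "cs_star_metrizable X \<longleftrightarrow>
     (\<exists>(M :: (nat \<Rightarrow> 'a set) topology) p s. metrizable_space M \<and> continuous_map M X p \<and>
        section_of M X p s \<and> cs_star_continuous X M s)"

lemma metrizable_closure_small_copy:
  fixes M :: "'m topology" and s :: "'a \<Rightarrow> 'm"
  assumes M: "metrizable_space M" and s: "s ` A \<subseteq> topspace M"
  obtains N :: "(nat \<Rightarrow> 'a set) topology" and g h
  where "metrizable_space N"
    and "homeomorphic_maps N (subtopology M (M closure_of (s ` A))) g h"
proof -
  define T where "T = M closure_of (s ` A)"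
  have TM: "T \<subseteq> topspace M"
    by (simp add: T_def closure_of_subset_topspace)
  have "\<exists>x. range x \<subseteq> A \<and> limitin M (\<lambda>n. s (x n)) t sequentially" if t: "t \<in> T" for t
  proof -
    obtain C d where "Metric_space C d" and Meq: "M = Metric_space.mtopology C d"
      using M metrizable_space_def by blast
    then interpret Metric_space C d by blast
    obtain \<sigma> where \<sigma>: "range \<sigma> \<subseteq> s ` A" "limitin M \<sigma> t sequentially"
      using t unfolding T_def Meq closure_of_sequentially by blast
    then have "\<forall>n. \<exists>a\<in>A. \<sigma> n = s a" by blast
    then obtain x where "\<And>n. x n \<in> A \<and> \<sigma> n = s (x n)" by metis
    then have "range x \<subseteq> A" "\<sigma> = (\<lambda>n. s (x n))" by auto
    with \<sigma> show ?thesis by blast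
  qed
  then obtain x where x: "\<And>t. t \<in> T \<Longrightarrow> limitin M (\<lambda>n. s (x t n)) t sequentially"
    by metis
  define h :: "'m \<Rightarrow> nat \<Rightarrow> 'a set" where "h = (\<lambda>t n. {x t n})"
  have inj: "inj_on h T"
  proof (rule inj_onI)
    fix t u assume tu: "t \<in> T" "u \<in> T" "h t = h u"
    then have "x t = x u" by (auto simp: h_def fun_eq_iff)
    with x[of t] x[of u] tu show "t = u"
      using limitin_Hausdorff_unique[OF _ _ _ metrizable_imp_Hausdorff_space[OF M]]
      by (metis trivial_limit_sequentially)
  qed
  define g where "g = inv_into T h"
  define N where "N = pullback_topology (h ` T) g (subtopology M T)"
  have gh: "g (h t) = t" if "t \<in> T" for t
    using that inj by (simp add: g_def)
  have topN: "topspace N = h ` T"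
    using TM gh by (auto simp: N_def topspace_pullback_topology)
  have "continuous_map N (subtopology M T) g"
    unfolding N_def using continuous_map_pullback[OF continuous_map_id] by simp
  moreover have "continuous_map (subtopology M T) N h"
    unfolding N_def
  proof (rule continuous_map_pullback')
    show "continuous_map (subtopology M T) (subtopology M T) (g \<circ> h)"
      by (rule continuous_map_eq[OF continuous_map_id]) (auto simp: gh)
    show "topspace (subtopology M T) \<subseteq> h -` h ` T" by auto
  qed
  ultimately have hom: "homeomorphic_maps N (subtopology M T) g h"
    unfolding homeomorphic_maps_def using topN gh by auto
  then have "N homeomorphic_space subtopology M T"
    unfolding homeomorphic_space_def by blast
  then have "metrizable_space N"
    using M homeomorphic_metrizable_space metrizable_space_subtopology by blast
  with hom that show thesis unfolding T_def by blast
qed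

theorem k_star_metrizableI:
  fixes M :: "'m topology"
  assumes M: "metrizable_space M" and f: "subproper_map M X f"
  shows "k_star_metrizable X"
proof -
  obtain Z where Z: "Z \<subseteq> topspace M" "f ` Z = topspace X"
    and pc: "\<And>K. precompactin X K \<Longrightarrow> precompactin M (Z \<inter> f -` K)"
    and contf: "continuous_map M X f"
    using f unfolding subproper_map_def by blast
  define s where "s = inv_into Z f"
  have s: "s y \<in> Z" "f (s y) = y" if "y \<in> topspace X" for y
    using that Z by (auto simp: s_def inv_into_into f_inv_into_f)
  define S where "S = s ` topspace X"
  define T where "T = M closure_of S"
  have SM: "S \<subseteq> topspace M" using s Z by (auto simp: S_def)
  have ST: "S \<subseteq> T" unfolding T_def using SM by (rule closure_of_subset)
  obtain N :: "(nat \<Rightarrow> 'a set) topology" and g h where N: "metrizable_space N"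
    and hom: "homeomorphic_maps N (subtopology M T) g h"
    using metrizable_closure_small_copy[OF M, of s "topspace X"] SM
    unfolding S_def T_def by blast
  have cg: "continuous_map N (subtopology M T) g" and ch: "continuous_map (subtopology M T) N h"
    and gh: "\<And>t. t \<in> T \<Longrightarrow> t \<in> topspace M \<Longrightarrow> g (h t) = t"
    using hom by (auto simp: homeomorphic_maps_def)
  have "subproper_map N X (f \<circ> g)"
    unfolding subproper_map_def
  proof (intro conjI exI allI impI)
    show "continuous_map N X (f \<circ> g)"
      using cg contf by (meson continuous_map_compose continuous_map_into_fulltopology)
    show hS: "h ` S \<subseteq> topspace N"
      using ch ST SM by (force simp: continuous_map_def)
    have ghS: "g (h t) = t" if "t \<in> S" for t using that ST SM gh by blast
    show "(f \<circ> g) ` (h ` S) = topspace X"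
      using s ghS by (force simp: S_def image_comp)
    fix K assume K: "precompactin X K"
    let ?C = "M closure_of (S \<inter> f -` K)"
    have "S \<subseteq> Z" using s by (auto simp: S_def)
    then have "?C \<subseteq> M closure_of (Z \<inter> f -` K)" by (intro closure_of_mono) blast
    then have "compactin M ?C"
      using pc[OF K] unfolding precompactin_def by (meson closed_compactin closedin_closure_of)
    moreover have "?C \<subseteq> T" unfolding T_def by (intro closure_of_mono) blast
    ultimately have "compactin (subtopology M T) ?C" by (simp add: compactin_subtopology)
    then have cN: "compactin N (h ` ?C)" using ch by (rule image_compactin)
    have sub: "h ` S \<inter> (f \<circ> g) -` K \<subseteq> h ` ?C"
    proof
      fix w assume "w \<in> h ` S \<inter> (f \<circ> g) -` K"
      then obtain t where "t \<in> S" "w = h t" "f t \<in> K" using ghS by auto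
      moreover have "S \<inter> f -` K \<subseteq> ?C" using SM by (intro closure_of_subset) blast
      ultimately show "w \<in> h ` ?C" by blast
    qed
    have "N closure_of (h ` S \<inter> (f \<circ> g) -` K) \<subseteq> h ` ?C"
      using sub compactin_imp_closedin[OF metrizable_imp_Hausdorff_space[OF N] cN]
      by (rule closure_of_minimal)
    then show "precompactin N (h ` S \<inter> (f \<circ> g) -` K)"
      unfolding precompactin_def using hS cN by (meson closed_compactin closedin_closure_of inf.coboundedI1)
  qed
  with N show ?thesis unfolding k_star_metrizable_def by blast
qed

theorem cs_star_metrizableI:
  fixes M :: "'m topology"
  assumes M: "metrizable_space M" and p: "continuous_map M X p"
    and s: "section_of M X p s" and cs: "cs_star_continuous X M s"
  shows "cs_star_metrizable X"
proof -
  define S where "S = s ` topspace X"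
  define T where "T = M closure_of S"
  have SM: "S \<subseteq> topspace M" using s by (auto simp: S_def section_of_def)
  have ST: "S \<subseteq> T" unfolding T_def using SM by (rule closure_of_subset)
  have TM: "T \<subseteq> topspace M" unfolding T_def by (rule closure_of_subset_topspace)
  obtain N :: "(nat \<Rightarrow> 'a set) topology" and g h where N: "metrizable_space N"
    and hom: "homeomorphic_maps N (subtopology M T) g h"
    using metrizable_closure_small_copy[OF M, of s "topspace X"] SM
    unfolding S_def T_def by blast
  have cg: "continuous_map N (subtopology M T) g" and ch: "continuous_map (subtopology M T) N h"
    and gh: "\<And>t. t \<in> T \<Longrightarrow> g (h t) = t"
    using hom TM by (auto simp: homeomorphic_maps_def)
  have hT: "h t \<in> topspace N" if "t \<in> T" for t
    using ch TM that by (auto simp: continuous_map_def)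
  have sT: "s y \<in> T" if "y \<in> topspace X" for y using that ST by (auto simp: S_def)
  have "continuous_map N X (p \<circ> g)"
    using cg p by (meson continuous_map_compose continuous_map_into_fulltopology)
  moreover have "section_of N X (p \<circ> g) (h \<circ> s)"
    using s sT hT gh by (auto simp: section_of_def)
  moreover have "cs_star_continuous X N (h \<circ> s)"
    unfolding cs_star_continuous_def
  proof (intro conjI allI impI)
    show "h \<circ> s \<in> topspace X \<rightarrow> topspace N" using sT hT by auto
    fix y l assume y: "range y \<subseteq> topspace X \<and> limitin X y l sequentially"
    then obtain x where x: "x \<in> topspace M"
      and acc: "\<And>U. openin M U \<Longrightarrow> x \<in> U \<Longrightarrow> infinite {n. s (y n) \<in> U}"
      using cs unfolding cs_star_continuous_def by meson
    have yT: "s (y n) \<in> S" for n using y by (auto simp: S_def)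
    have xT: "x \<in> T"
    proof -
      have "\<exists>z\<in>S. z \<in> U" if "openin M U" "x \<in> U" for U
        using acc[OF that] yT by (metis (mono_tags, lifting) Collect_empty_eq finite.emptyI)
      then show ?thesis using x unfolding T_def by (auto simp: in_closure_of)
    qed
    have "infinite {n. (h \<circ> s) (y n) \<in> U}" if U: "openin N U" "h x \<in> U" for U
    proof -
      have "openin (subtopology M T) {t \<in> topspace (subtopology M T). h t \<in> U}"
        using ch U by (auto simp: continuous_map_def)
      then obtain V where V: "openin M V" "{t \<in> topspace (subtopology M T). h t \<in> U} = V \<inter> T"
        by (auto simp: openin_subtopology)
      then have "x \<in> V" using xT x U by auto
      then have "infinite {n. s (y n) \<in> V}" using acc V by blast
      moreover have "{n. s (y n) \<in> V} \<subseteq> {n. (h \<circ> s) (y n) \<in> U}"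
        using V yT ST by auto
      ultimately show ?thesis using finite_subset by blast
    qed
    then show "\<exists>x\<in>topspace N. \<forall>U. openin N U \<and> x \<in> U \<longrightarrow> infinite {n. (h \<circ> s) (y n) \<in> U}"
      using hT[OF xT] by blast
  qed
  ultimately show ?thesis using N unfolding cs_star_metrizable_def by blast
qed

section \<open>Sequential notions\<close>

definition sequentially_compact_space :: "'a topology \<Rightarrow> bool" where
  "sequentially_compact_space X \<longleftrightarrow>
     (\<forall>\<sigma>. range \<sigma> \<subseteq> topspace X \<longrightarrow>
        (\<exists>r l. strict_mono (r :: nat \<Rightarrow> nat) \<and> limitin X (\<sigma> \<circ> r) l sequentially))"

definition cl1 :: "'a topology \<Rightarrow> 'a set \<Rightarrow> 'a set" where
  "cl1 X A = {x. \<exists>a. range a \<subseteq> A \<and> limitin X a x sequentially}"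

text \<open>Since \<open>cl1\<close> is monotone, it is immaterial here whether neighborhoods are required
  to be open; the same holds for the neighborhoods in \<open>cs_star_continuous\<close> and \<open>Nw\<close>.\<close>

definition sequentially_regular :: "'a topology \<Rightarrow> bool" where
  "sequentially_regular X \<longleftrightarrow>
     (\<forall>U x. openin X U \<and> x \<in> U \<longrightarrow> (\<exists>V. openin X V \<and> x \<in> V \<and> cl1 X V \<subseteq> U))"

section \<open>The Network Hyperspace\<close>

definition Nw :: "'a topology \<Rightarrow> 'a \<Rightarrow> (nat \<Rightarrow> 'a set) set" where
  "Nw X x = {A. (\<forall>n. A n \<subseteq> topspace X \<and> A n \<noteq> {} \<and> A (Suc n) \<subseteq> A n) \<and>
                (\<forall>U. openin X U \<and> x \<in> U \<longrightarrow> (\<exists>n. cl1 X (A n) \<subseteq> U))}"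

definition Nw_space :: "'a topology \<Rightarrow> (nat \<Rightarrow> 'a set) topology" where
  "Nw_space X =
     subtopology (product_topology (\<lambda>_. discrete_topology (Pow (topspace X))) UNIV)
                 (\<Union>x\<in>topspace X. Nw X x)"

definition Nw_lim :: "'a topology \<Rightarrow> (nat \<Rightarrow> 'a set) \<Rightarrow> 'a" where
  "Nw_lim X A = (THE x. x \<in> topspace X \<and> A \<in> Nw X x)"

lemma subset_cl1: "A \<subseteq> topspace X \<Longrightarrow> A \<subseteq> cl1 X A"
proof
  fix a assume "A \<subseteq> topspace X" "a \<in> A"
  then have "range (\<lambda>n::nat. a) \<subseteq> A" "limitin X (\<lambda>n. a) a sequentially"
    by auto
  then show "a \<in> cl1 X A" unfolding cl1_def by blast
qed

lemma topspace_Nw_space: "topspace (Nw_space X) = (\<Union>x\<in>topspace X. Nw X x)"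
  by (auto simp: Nw_space_def Nw_def)

lemma Nw_lim_eq:
  assumes "Hausdorff_space X" and x: "x \<in> topspace X" "A \<in> Nw X x"
  shows "Nw_lim X A = x"
  unfolding Nw_lim_def
proof (rule the_equality)
  fix y assume y: "y \<in> topspace X \<and> A \<in> Nw X y"
  show "y = x"
  proof (rule ccontr)
    assume "y \<noteq> x"
    then obtain U V where UV: "openin X U" "openin X V" "y \<in> U" "x \<in> V" "disjnt U V"
      using assms y unfolding Hausdorff_space_def by metis
    obtain m where "cl1 X (A m) \<subseteq> U" using UV y by (auto simp: Nw_def)
    moreover obtain n where "cl1 X (A n) \<subseteq> V" using UV x by (auto simp: Nw_def)
    moreover have "decseq A" using x by (auto simp: Nw_def decseq_Suc_iff)
    then have "A (max m n) \<subseteq> A m" "A (max m n) \<subseteq> A n" by (simp_all add: decseqD)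
    moreover have "A m \<subseteq> cl1 X (A m)" "A n \<subseteq> cl1 X (A n)" "A (max m n) \<noteq> {}"
      using x by (auto simp: Nw_def intro!: subset_cl1[THEN subsetD])
    ultimately show False using UV unfolding disjnt_def by blast
  qed
qed (use x in auto)

section \<open>Networks\<close>

definition k_network :: "'a topology \<Rightarrow> 'a set set \<Rightarrow> bool" where
  "k_network X \<N> \<longleftrightarrow> (\<forall>N\<in>\<N>. N \<subseteq> topspace X) \<and>
     (\<forall>U K. openin X U \<and> compactin X K \<and> K \<subseteq> U \<longrightarrow>
        (\<exists>\<F>. finite \<F> \<and> \<F> \<subseteq> \<N> \<and> K \<subseteq> \<Union>\<F> \<and> \<Union>\<F> \<subseteq> U))"

definition cl1osed_k_network :: "'a topology \<Rightarrow> 'a set set \<Rightarrow> bool" where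
  "cl1osed_k_network X \<N> \<longleftrightarrow> (\<forall>N\<in>\<N>. N \<subseteq> topspace X) \<and>
     (\<forall>U K. openin X U \<and> compactin X K \<and> K \<subseteq> U \<longrightarrow>
        (\<exists>\<F>. finite \<F> \<and> \<F> \<subseteq> \<N> \<and> K \<subseteq> \<Union>\<F> \<and> \<Union>\<F> \<subseteq> cl1 X (\<Union>\<F>) \<and> cl1 X (\<Union>\<F>) \<subseteq> U))"

definition cl1osed_cs_star_network :: "'a topology \<Rightarrow> 'a set set \<Rightarrow> bool" where
  "cl1osed_cs_star_network X \<N> \<longleftrightarrow> (\<forall>N\<in>\<N>. N \<subseteq> topspace X) \<and>
     (\<forall>U x l. openin X U \<and> range x \<subseteq> U \<and> l \<in> U \<and> limitin X x l sequentially \<longrightarrow>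
        (\<exists>N\<in>\<N>. infinite {n. x n \<in> N} \<and> cl1 X N \<subseteq> U))"

definition compact_finite :: "'a topology \<Rightarrow> 'a set set \<Rightarrow> bool" where
  "compact_finite X \<A> \<longleftrightarrow> (\<forall>K. compactin X K \<longrightarrow> finite {A\<in>\<A>. A \<inter> K \<noteq> {}})"

text \<open>Including the limit in the set \<open>range x\<close> makes no difference, because the sequence
  \<open>l, x 0, l, x 1, \<dots>\<close> converges to \<open>l\<close> as well.\<close>

definition cs_finite :: "'a topology \<Rightarrow> 'a set set \<Rightarrow> bool" where
  "cs_finite X \<A> \<longleftrightarrow>
     (\<forall>x l. range x \<subseteq> topspace X \<and> limitin X x l sequentially \<longrightarrow>
        finite {A\<in>\<A>. A \<inter> range x \<noteq> {}})"

definition sigma_compact_finite :: "'a topology \<Rightarrow> 'a set set \<Rightarrow> bool" where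
  "sigma_compact_finite X \<A> \<longleftrightarrow>
     (\<exists>\<B> :: nat \<Rightarrow> 'a set set. \<A> = (\<Union>n. \<B> n) \<and> (\<forall>n. compact_finite X (\<B> n)))"

definition sigma_cs_finite :: "'a topology \<Rightarrow> 'a set set \<Rightarrow> bool" where
  "sigma_cs_finite X \<A> \<longleftrightarrow>
     (\<exists>\<B> :: nat \<Rightarrow> 'a set set. \<A> = (\<Union>n. \<B> n) \<and> (\<forall>n. cs_finite X (\<B> n)))"

end

theory Submission
  imports Defs
begin

text \<open>
  The equivalence is a cycle through the five conditions, in the following order.

  From \<open>k\<^sup>*\<close>- to \<open>cs\<^sup>*\<close>-metrizability: a section with values in the set \<open>Z\<close> of the subproper map
  sends compact sets to precompact sets of a metrizable space, where every sequence has a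
  convergent subsequence; the continuous map carries the limit back. This shows both that the
  section is \<open>cs\<^sup>*\<close>-continuous and that compact sets are sequentially compact.

  To a \<open>\<sigma>\<close>-cs-finite \<open>cs\<^sup>*\<close>-network: a metrizable space has a \<open>\<sigma>\<close>-locally-finite base (Stone). Its
  preimages under the section form the network. They are cs-finite because every subsequence of
  a lifted convergent sequence accumulates, so that the lift cannot meet infinitely many members
  of a locally finite family; their sequential closures are controlled because a limit of points
  of the preimage of \<open>B\<close> is the image of a point in the closure of \<open>B\<close>.

  To a \<open>\<sigma>\<close>-compact-finite \<open>k\<close>-network: the same family works. Sequential compactness of compacta
  turns cs-finite into compact-finite. Hence only countably many members meet a given compact set
  \<open>K\<close>, and if no finite number of them covered \<open>K\<close>, a sequence of uncovered points would have a
  subsequence converging to a point of \<open>K\<close>, against the \<open>cs\<^sup>*\<close>-network property.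

  To a section of the limit map: if the network is the union of compact-finite families
  \<open>\<B> 0, \<B> 1, \<dots>\<close>, let the \<open>n\<close>-th set of \<open>s x\<close> be the intersection of the finitely many members of
  \<open>\<B> 0, \<dots>, \<B> n\<close> that contain \<open>x\<close>. Over a compact set each coordinate of \<open>s\<close> takes finitely many
  values, so the image lies in a compact product of finite sets; the network property shows that
  every point in the closure of the image is again a network at some point of \<open>X\<close>.

  Back to \<open>k\<^sup>*\<close>-metrizability: the Network Hyperspace is a subspace of a countable power of a
  discrete space, hence metrizable, and the image of the section witnesses that its limit map is
  subproper.

  In a sequentially regular space every \<open>k\<close>-network already satisfies the closure
  condition: cut a compact set into finitely many compact pieces, each inside an open set
  whose sequential closure is small.
\<close>

section \<open>A sigma-locally-finite base of a metrizable space\<close>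

text \<open>
  The classical argument of Stone: every point is assigned to the first ball, in a
  well-ordering of the centres, that contains it, and the points that are deep enough inside
  their ball are thickened a little. Points assigned to different balls and both deep inside them
  are far apart, which makes the thickened sets a locally finite open family.
\<close>

context Metric_space
begin

text \<open>
  With \<open>c a\<close> the first centre of an \<open>\<epsilon>\<close>-ball around \<open>a\<close>, the separation property says that of two
  different chosen balls the earlier one misses the point that was assigned to the later
  one. In this symmetric form the well-ordering itself disappears from later arguments.
\<close>

lemma well_ordered_ball_centres:
  assumes "\<epsilon> > 0"
  obtains c where "\<And>a. a \<in> M \<Longrightarrow> c a \<in> M \<and> d (c a) a < \<epsilon>"
    and "\<And>a b. \<lbrakk>a \<in> M; b \<in> M; c a \<noteq> c b\<rbrakk> \<Longrightarrow> \<epsilon> \<le> d (c a) b \<or> \<epsilon> \<le> d (c b) a"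
proof -
  obtain r :: "'a rel" where r: "Well_order r" "Field r = UNIV"
    using well_ordering[where 'a = 'a] by metis
  then have wf: "wf (r - Id)"
    by (simp add: well_order_on_def)
  have total: "(x, y) \<in> r \<or> (y, x) \<in> r" if "x \<noteq> y" for x y
    using r that by (auto simp: well_order_on_def linear_order_on_def total_on_def)
  have "\<exists>x\<in>M. d x a < \<epsilon> \<and> (\<forall>y\<in>M. (y, x) \<in> r - Id \<longrightarrow> \<epsilon> \<le> d y a)" if "a \<in> M" for a
  proof -
    have "a \<in> {x \<in> M. d x a < \<epsilon>}" using that assms by simp
    then obtain z where "z \<in> {x \<in> M. d x a < \<epsilon>}"
      and "\<And>y. (y, z) \<in> r - Id \<Longrightarrow> y \<notin> {x \<in> M. d x a < \<epsilon>}"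
      by (rule wfE_min[OF wf]) blast
    then show ?thesis by (intro bexI[of _ z]) force+
  qed
  then obtain c where "\<And>a. a \<in> M \<Longrightarrow> c a \<in> M \<and> d (c a) a < \<epsilon> \<and>
      (\<forall>y\<in>M. (y, c a) \<in> r - Id \<longrightarrow> \<epsilon> \<le> d y a)"
    by metis
  then show thesis using that[of c] total by (metis DiffI IdE prod.inject pair_in_Id_conv)
qed

text \<open>
  The depth \<open>\<delta>\<close> separates the layers: \<open>core \<delta> x\<close> consists of the points assigned to the centre
  \<open>x\<close> whose \<open>\<delta>\<close>-ball stays in the \<open>\<epsilon>\<close>-ball of \<open>x\<close>, and points of different cores are at distance at
  least \<open>\<delta>\<close>. A fixed point lies in all layers of sufficiently small depth, so any sequence of
  depths that tends to zero yields a countable family of layers covering the space.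
\<close>

lemma sigma_locally_finite_small_open_cover:
  assumes \<epsilon>: "\<epsilon> > 0"
  obtains \<E> :: "real \<Rightarrow> 'a set set"
  where "\<And>\<delta>. \<delta> > 0 \<Longrightarrow> locally_finite_in mtopology (\<E> \<delta>)"
    and "\<And>\<delta> E. E \<in> \<E> \<delta> \<Longrightarrow> openin mtopology E \<and> (\<exists>x\<in>M. E \<subseteq> mball x \<epsilon>)"
    and "\<And>a. a \<in> M \<Longrightarrow> \<exists>\<delta>\<^sub>0>0. \<forall>\<delta>. 0 < \<delta> \<and> \<delta> \<le> \<delta>\<^sub>0 \<longrightarrow> a \<in> \<Union>(\<E> \<delta>)"
proof -
  obtain c where c: "\<And>a. a \<in> M \<Longrightarrow> c a \<in> M \<and> d (c a) a < \<epsilon>"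
    and sep: "\<And>a b. \<lbrakk>a \<in> M; b \<in> M; c a \<noteq> c b\<rbrakk> \<Longrightarrow> \<epsilon> \<le> d (c a) b \<or> \<epsilon> \<le> d (c b) a"
    using well_ordered_ball_centres[OF \<epsilon>] by blast
  define core where "core \<delta> x = {a \<in> M. c a = x \<and> mball a \<delta> \<subseteq> mball x \<epsilon>}" for \<delta> x
  define E where "E \<delta> x = (\<Union>a\<in>core \<delta> x. mball a (\<delta>/3))" for \<delta> x
  have far: "\<delta> \<le> d a b" if "a \<in> core \<delta> x" "b \<in> core \<delta> y" "x \<noteq> y" for a b x y \<delta>
  proof (rule ccontr)
    assume "\<not> \<delta> \<le> d a b"
    with that have "b \<in> mball a \<delta>" "a \<in> mball b \<delta>" by (auto simp: core_def commute)
    with that have "d (c a) b < \<epsilon>" "d (c b) a < \<epsilon>" by (auto simp: core_def)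
    with sep[of a b] that show False by (auto simp: core_def)
  qed
  show thesis
  proof (rule that[of "\<lambda>\<delta>. E \<delta> ` M"])
    fix \<delta> :: real assume \<delta>: "\<delta> > 0"
    show "locally_finite_in mtopology (E \<delta> ` M)"
      unfolding locally_finite_in_def
    proof (intro conjI ballI)
      show "\<Union>(E \<delta> ` M) \<subseteq> topspace mtopology" by (auto simp: E_def)
      fix z assume "z \<in> topspace mtopology"
      then have z: "z \<in> M" by simp
      \<comment> \<open>Two thickenings by \<open>\<delta>/3\<close> that both come within \<open>\<delta>/6\<close> of \<open>z\<close> have cores less than \<open>\<delta>\<close> apart.\<close>
      let ?W = "mball z (\<delta>/6)"
      have same: "x = y" if xy: "E \<delta> x \<inter> ?W \<noteq> {}" "E \<delta> y \<inter> ?W \<noteq> {}" for x y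
      proof (rule ccontr)
        assume "x \<noteq> y"
        obtain u v where u: "u \<in> E \<delta> x" "u \<in> ?W" and v: "v \<in> E \<delta> y" "v \<in> ?W" using xy by blast
        obtain a where a: "a \<in> core \<delta> x" "d a u < \<delta>/3" using u by (auto simp: E_def)
        obtain b where b: "b \<in> core \<delta> y" "d b v < \<delta>/3" using v by (auto simp: E_def)
        have M: "a \<in> M" "b \<in> M" "u \<in> M" "v \<in> M" using a b u v by (auto simp: core_def)
        have "d a b \<le> d a u + d u z + d z v + d v b"
          using M z triangle[of a u b] triangle[of u z b] triangle[of z v b] by linarith
        also have "\<dots> < \<delta>/3 + \<delta>/6 + \<delta>/6 + \<delta>/3"
          using a b u v by (auto simp: commute)
        finally show False using far[OF a(1) b(1) \<open>x \<noteq> y\<close>] by linarith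
      qed
      have "finite {U \<in> E \<delta> ` M. U \<inter> ?W \<noteq> {}}"
      proof (cases "\<exists>x. E \<delta> x \<inter> ?W \<noteq> {}")
        case True
        then obtain x where x: "E \<delta> x \<inter> ?W \<noteq> {}" by blast
        have "{U \<in> E \<delta> ` M. U \<inter> ?W \<noteq> {}} \<subseteq> {E \<delta> x}"
          using same[OF x] by auto
        then show ?thesis by (rule finite_subset) simp
      next
        case False
        then have none: "{U \<in> E \<delta> ` M. U \<inter> ?W \<noteq> {}} = {}" by auto
        show ?thesis unfolding none by simp
      qed
      then show "\<exists>V. openin mtopology V \<and> z \<in> V \<and> finite {U \<in> E \<delta> ` M. U \<inter> V \<noteq> {}}"
        using z \<delta> by (intro exI[of _ ?W]) auto
    qed
  next
    fix \<delta> F assume "F \<in> E \<delta> ` M"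
    then obtain x where x: "x \<in> M" "F = E \<delta> x" by blast
    have "mball a (\<delta>/3) \<subseteq> mball x \<epsilon>" if "a \<in> core \<delta> x" for a
    proof (cases "\<delta> \<le> 0")
      case False
      then have "mball a (\<delta>/3) \<subseteq> mball a \<delta>" by auto
      with that show ?thesis by (auto simp: core_def)
    next
      case True
      then have "mball a (\<delta>/3) = {}" by (simp add: mball_eq_empty)
      then show ?thesis by simp
    qed
    with x show "openin mtopology F \<and> (\<exists>x\<in>M. F \<subseteq> mball x \<epsilon>)"
      by (auto simp: E_def)
  next
    fix a assume a: "a \<in> M"
    then have ca: "c a \<in> M" "a \<in> mball (c a) \<epsilon>" using c by auto
    then obtain \<delta>0 where \<delta>0: "\<delta>0 > 0" "mball a \<delta>0 \<subseteq> mball (c a) \<epsilon>"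
      using openin_mball[of "c a" \<epsilon>] unfolding openin_mtopology by blast
    have "a \<in> \<Union>(E \<delta> ` M)" if "0 < \<delta>" "\<delta> \<le> \<delta>0" for \<delta>
    proof -
      have "mball a \<delta> \<subseteq> mball a \<delta>0" using that by auto
      then have "a \<in> core \<delta> (c a)" using a \<delta>0 by (auto simp: core_def)
      then have "a \<in> E \<delta> (c a)" using a that by (auto simp: E_def)
      then show ?thesis using ca by blast
    qed
    with \<delta>0 show "\<exists>\<delta>\<^sub>0>0. \<forall>\<delta>. 0 < \<delta> \<and> \<delta> \<le> \<delta>\<^sub>0 \<longrightarrow> a \<in> \<Union>(E \<delta> ` M)" by blast
  qed
qed

end

text \<open>
  The countably many pairs of a radius and a depth, both of the form \<open>1/(n+1)\<close>, enumerate
  enough of the layers to obtain a base.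
\<close>

theorem metrizable_space_sigma_locally_finite_base:
  assumes "metrizable_space X"
  obtains \<B> :: "nat \<Rightarrow> 'a set set"
  where "\<And>n. locally_finite_in X (\<B> n)"
    and "\<And>n B. B \<in> \<B> n \<Longrightarrow> openin X B"
    and "\<And>U x. \<lbrakk>openin X U; x \<in> U\<rbrakk> \<Longrightarrow> \<exists>n. \<exists>B\<in>\<B> n. x \<in> B \<and> B \<subseteq> U"
proof -
  obtain M d where "Metric_space M d" and X: "X = Metric_space.mtopology M d"
    using assms metrizable_space_def by blast
  then interpret Metric_space M d by blast
  define good :: "real \<Rightarrow> (real \<Rightarrow> 'a set set) \<Rightarrow> bool" where
    "good \<epsilon> \<E> \<longleftrightarrow> (\<forall>\<delta>>0. locally_finite_in X (\<E> \<delta>)) \<and>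
      (\<forall>\<delta>. \<forall>E\<in>\<E> \<delta>. openin X E \<and> (\<exists>x\<in>M. E \<subseteq> mball x \<epsilon>)) \<and>
      (\<forall>a\<in>M. \<exists>\<delta>\<^sub>0>0. \<forall>\<delta>. 0 < \<delta> \<and> \<delta> \<le> \<delta>\<^sub>0 \<longrightarrow> a \<in> \<Union>(\<E> \<delta>))" for \<epsilon> \<E>
  have "\<exists>\<E>. good \<epsilon> \<E>" if "\<epsilon> > 0" for \<epsilon>
  proof (rule sigma_locally_finite_small_open_cover[OF that])
    fix \<E> :: "real \<Rightarrow> 'a set set"
    assume "\<And>\<delta>. 0 < \<delta> \<Longrightarrow> locally_finite_in mtopology (\<E> \<delta>)"
      and "\<And>\<delta> E. E \<in> \<E> \<delta> \<Longrightarrow> openin mtopology E \<and> (\<exists>x\<in>M. E \<subseteq> mball x \<epsilon>)"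
      and "\<And>a. a \<in> M \<Longrightarrow> \<exists>\<delta>\<^sub>0>0. \<forall>\<delta>. 0 < \<delta> \<and> \<delta> \<le> \<delta>\<^sub>0 \<longrightarrow> a \<in> \<Union>(\<E> \<delta>)"
    then show ?thesis unfolding X good_def by (intro exI[of _ \<E>]) simp
  qed
  then obtain \<E> where "\<And>\<epsilon>. \<epsilon> > 0 \<Longrightarrow> good \<epsilon> (\<E> \<epsilon>)" by metis
  then have lf: "\<And>\<epsilon> \<delta>. \<lbrakk>\<epsilon> > 0; \<delta> > 0\<rbrakk> \<Longrightarrow> locally_finite_in X (\<E> \<epsilon> \<delta>)"
    and small: "\<And>\<epsilon> \<delta> E. \<lbrakk>\<epsilon> > 0; E \<in> \<E> \<epsilon> \<delta>\<rbrakk> \<Longrightarrow> openin X E \<and> (\<exists>x\<in>M. E \<subseteq> mball x \<epsilon>)"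
    and cover: "\<And>\<epsilon> a. \<lbrakk>\<epsilon> > 0; a \<in> M\<rbrakk> \<Longrightarrow> \<exists>\<delta>\<^sub>0>0. \<forall>\<delta>. 0 < \<delta> \<and> \<delta> \<le> \<delta>\<^sub>0 \<longrightarrow> a \<in> \<Union>(\<E> \<epsilon> \<delta>)"
    unfolding good_def by simp_all
  define q where "q i = inverse (real (Suc i))" for i
  have q: "q i > 0" for i by (simp add: q_def)
  define \<B> where "\<B> n = \<E> (q (fst (prod_decode n))) (q (snd (prod_decode n)))" for n
  show thesis
  proof (rule that[of \<B>])
    show "locally_finite_in X (\<B> n)" for n by (simp add: \<B>_def lf q)
    show "openin X B" if "B \<in> \<B> n" for n B using that small q by (auto simp: \<B>_def)
    fix U x assume U: "openin X U" "x \<in> U"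
    then obtain \<rho> where \<rho>: "\<rho> > 0" "mball x \<rho> \<subseteq> U" and x: "x \<in> M"
      unfolding X openin_mtopology by blast
    obtain i where i: "q i < \<rho>/2"
      using reals_Archimedean[of "\<rho>/2"] \<rho> unfolding q_def by auto
    obtain \<delta>0 where \<delta>0: "\<delta>0 > 0" "\<And>\<delta>. \<lbrakk>0 < \<delta>; \<delta> \<le> \<delta>0\<rbrakk> \<Longrightarrow> x \<in> \<Union>(\<E> (q i) \<delta>)"
      using cover[OF q x, of i] by metis
    obtain j where j: "q j < \<delta>0" using reals_Archimedean[OF \<delta>0(1)] unfolding q_def by auto
    then obtain B where B: "B \<in> \<E> (q i) (q j)" "x \<in> B" using \<delta>0(2)[of "q j"] q[of j] by auto
    then obtain y where y: "y \<in> M" "B \<subseteq> mball y (q i)" using small q by meson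
    have "B \<subseteq> mball x \<rho>"
    proof
      fix b assume "b \<in> B"
      then have "d y b < q i" "d y x < q i" "b \<in> M" using y B by auto
      then show "b \<in> mball x \<rho>"
        using i x y triangle[of x y b] by (auto simp: commute)
    qed
    moreover have "B \<in> \<B> (prod_encode (i, j))" using B by (simp add: \<B>_def)
    ultimately show "\<exists>n. \<exists>B\<in>\<B> n. x \<in> B \<and> B \<subseteq> U" using \<rho> B by blast
  qed
qed

section \<open>Accumulation points\<close>

text \<open>
  This is what makes a \<open>cs\<^sup>*\<close>-continuous section useful: in a metrizable space the accumulation
  points that it provides are limits of subsequences.
\<close>

lemma metrizable_space_accumulation_subsequence:
  assumes "metrizable_space X" and x: "x \<in> topspace X"
    and acc: "\<And>U. \<lbrakk>openin X U; x \<in> U\<rbrakk> \<Longrightarrow> infinite {n::nat. \<sigma> n \<in> U}"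
  obtains r :: "nat \<Rightarrow> nat" where "strict_mono r" "limitin X (\<sigma> \<circ> r) x sequentially"
proof -
  obtain M d where "Metric_space M d" and X: "X = Metric_space.mtopology M d"
    using assms metrizable_space_def by blast
  then interpret Metric_space M d by blast
  have xM: "x \<in> M" using x X by simp
  have "\<exists>r. \<forall>k. (\<sigma> (r k) \<in> mball x (inverse (real (Suc k)))) \<and> r k < r (Suc k)"
  proof (rule dependent_nat_choice)
    have "infinite {n. \<sigma> n \<in> mball x (inverse (real (Suc 0)))}"
      by (rule acc) (use xM X in auto)
    then show "\<exists>m. \<sigma> m \<in> mball x (inverse (real (Suc 0)))"
      using not_finite_existsD by blast
    fix m k
    have "infinite {n. \<sigma> n \<in> mball x (inverse (real (Suc (Suc k))))}"
      by (rule acc) (use xM X in auto)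
    then show "\<exists>n. \<sigma> n \<in> mball x (inverse (real (Suc (Suc k)))) \<and> m < n"
      unfolding infinite_nat_iff_unbounded by blast
  qed
  then obtain r where r: "\<And>k. \<sigma> (r k) \<in> mball x (inverse (real (Suc k)))" "strict_mono r"
    by (auto simp: strict_mono_Suc_iff)
  have "limitin X (\<sigma> \<circ> r) x sequentially"
    unfolding X limitin_metric
  proof (intro conjI allI impI)
    fix \<epsilon> :: real assume "\<epsilon> > 0"
    then have "\<forall>\<^sub>F k in sequentially. inverse (real (Suc k)) < \<epsilon>"
      using LIMSEQ_inverse_real_of_nat by (rule order_tendstoD(2)[rotated])
    then show "\<forall>\<^sub>F k in sequentially. (\<sigma> \<circ> r) k \<in> M \<and> d ((\<sigma> \<circ> r) k) x < \<epsilon>"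
    proof (rule eventually_mono)
      show "(\<sigma> \<circ> r) k \<in> M \<and> d ((\<sigma> \<circ> r) k) x < \<epsilon>" if "inverse (real (Suc k)) < \<epsilon>" for k
        using r(1)[of k] that by (auto simp: commute)
    qed
  qed (rule xM)
  with r that show thesis by blast
qed

lemma compactin_imp_accumulation_point:
  assumes K: "compactin X K" and \<sigma>: "\<And>n::nat. \<sigma> n \<in> K"
  obtains x where "x \<in> K" "\<And>U. \<lbrakk>openin X U; x \<in> U\<rbrakk> \<Longrightarrow> infinite {n. \<sigma> n \<in> U}"
proof (rule ccontr)
  assume "\<not> thesis"
  with that have "\<forall>x\<in>K. \<exists>U. openin X U \<and> x \<in> U \<and> finite {n. \<sigma> n \<in> U}" by blast
  then obtain U where U: "\<And>x. x \<in> K \<Longrightarrow> openin X (U x) \<and> x \<in> U x \<and> finite {n. \<sigma> n \<in> U x}"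
    by metis
  then have "\<exists>\<U>. finite \<U> \<and> \<U> \<subseteq> U ` K \<and> K \<subseteq> \<Union>\<U>"
    by (intro compactinD[OF K]) auto
  then obtain F where F: "finite F" "F \<subseteq> K" "K \<subseteq> \<Union>(U ` F)" by (metis finite_subset_image)
  have "(UNIV :: nat set) \<subseteq> (\<Union>x\<in>F. {n. \<sigma> n \<in> U x})" using F \<sigma> by blast
  moreover have "finite (\<Union>x\<in>F. {n. \<sigma> n \<in> U x})" using F U by blast
  ultimately show False using finite_subset infinite_UNIV_nat by blast
qed

lemma compactin_imp_precompactin:
  "\<lbrakk>Hausdorff_space X; compactin X K\<rbrakk> \<Longrightarrow> precompactin X K"
  by (simp add: precompactin_def closure_of_closedin compactin_imp_closedin compactin_subset_topspace)

lemma precompactin_sequence: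
  assumes M: "metrizable_space M" and A: "precompactin M A" and \<sigma>: "range \<sigma> \<subseteq> A"
  obtains r z where "strict_mono (r :: nat \<Rightarrow> nat)" "z \<in> topspace M" "limitin M (\<sigma> \<circ> r) z sequentially"
proof -
  have "\<sigma> n \<in> M closure_of A" for n
    using A \<sigma> closure_of_subset unfolding precompactin_def by blast
  then obtain z where z: "z \<in> M closure_of A" "\<And>U. \<lbrakk>openin M U; z \<in> U\<rbrakk> \<Longrightarrow> infinite {n. \<sigma> n \<in> U}"
    using compactin_imp_accumulation_point[of M "M closure_of A" \<sigma>] A
    unfolding precompactin_def by blast
  have zM: "z \<in> topspace M" using z(1) by (meson closure_of_subset_topspace subsetD)
  show thesis
    using metrizable_space_accumulation_subsequence[OF M zM z(2)] zM that by blast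
qed

section \<open>Sequential closures and networks\<close>

lemma cl1_mono: "A \<subseteq> B \<Longrightarrow> cl1 X A \<subseteq> cl1 X B"
  unfolding cl1_def by blast

text \<open>
  By the pigeonhole principle a sequence in a finite union is frequently in one member.
\<close>

lemma cl1_Union_finite:
  assumes "finite \<F>"
  shows "cl1 X (\<Union>\<F>) \<subseteq> (\<Union>F\<in>\<F>. cl1 X F)"
proof
  fix x assume "x \<in> cl1 X (\<Union>\<F>)"
  then obtain a where a: "range a \<subseteq> \<Union>\<F>" "limitin X a x sequentially" by (auto simp: cl1_def)
  have "\<exists>F\<in>\<F>. a n \<in> F" for n using a by (auto simp: image_subset_iff)
  then have "(UNIV :: nat set) = (\<Union>F\<in>\<F>. {n. a n \<in> F})" by auto
  then obtain F where F: "F \<in> \<F>" "infinite {n. a n \<in> F}"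
    using assms infinite_UNIV_nat by (metis (no_types, lifting) finite_UN_I)
  then obtain r :: "nat \<Rightarrow> nat" where r: "strict_mono r" "\<And>n. a (r n) \<in> F"
    using infinite_enumerate by blast
  then have "x \<in> cl1 X F"
    unfolding cl1_def using limitin_subsequence[OF r(1) a(2)]
    by (intro CollectI exI[of _ "a \<circ> r"]) auto
  with F show "x \<in> (\<Union>F\<in>\<F>. cl1 X F)" by blast
qed

lemma k_networkD:
  assumes "k_network X \<N>" "openin X U" "compactin X K" "K \<subseteq> U"
  shows "\<exists>\<F>. finite \<F> \<and> \<F> \<subseteq> \<N> \<and> K \<subseteq> \<Union>\<F> \<and> \<Union>\<F> \<subseteq> U"
  using assms by (simp add: k_network_def)

lemma cl1osed_k_networkD:
  assumes "cl1osed_k_network X \<N>" "openin X U" "compactin X K" "K \<subseteq> U"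
  shows "\<exists>\<F>. finite \<F> \<and> \<F> \<subseteq> \<N> \<and> K \<subseteq> \<Union>\<F> \<and> cl1 X (\<Union>\<F>) \<subseteq> U"
proof -
  have "\<exists>\<F>. finite \<F> \<and> \<F> \<subseteq> \<N> \<and> K \<subseteq> \<Union>\<F> \<and> \<Union>\<F> \<subseteq> cl1 X (\<Union>\<F>) \<and> cl1 X (\<Union>\<F>) \<subseteq> U"
    using assms by (simp add: cl1osed_k_network_def)
  then show ?thesis by (elim exE conjE) (intro exI conjI)
qed

section \<open>From metrizable preimages to networks\<close>

theorem k_star_metrizable_imp_cs_star_metrizable:
  assumes X: "Hausdorff_space X" and k: "k_star_metrizable X"
  shows "cs_star_metrizable X \<and>
    (\<forall>K. compactin X K \<longrightarrow> sequentially_compact_space (subtopology X K))"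
proof -
  obtain M :: "(nat \<Rightarrow> 'a set) topology" and f where M: "metrizable_space M" and f: "subproper_map M X f"
    using k unfolding k_star_metrizable_def by blast
  obtain Z where Z: "Z \<subseteq> topspace M" "f ` Z = topspace X"
    and pc: "\<And>K. precompactin X K \<Longrightarrow> precompactin M (Z \<inter> f -` K)"
    and contf: "continuous_map M X f"
    using f unfolding subproper_map_def by blast
  define s where "s = inv_into Z f"
  have s: "s y \<in> Z" "f (s y) = y" if "y \<in> topspace X" for y
    using that Z by (auto simp: s_def inv_into_into f_inv_into_f)
  have lift: "\<exists>r z. strict_mono r \<and> z \<in> topspace M \<and> limitin M (s \<circ> y \<circ> r) z sequentially"
    if K: "compactin X K" and y: "range y \<subseteq> K" for K and y :: "nat \<Rightarrow> 'a"
  proof -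
    have "range (s \<circ> y) \<subseteq> Z \<inter> f -` K"
      using y s compactin_subset_topspace[OF K] by fastforce
    then show ?thesis
      using precompactin_sequence[OF M pc[OF compactin_imp_precompactin[OF X K]]] by metis
  qed
  have "sequentially_compact_space (subtopology X K)" if K: "compactin X K" for K
    unfolding sequentially_compact_space_def
  proof (intro allI impI)
    fix y :: "nat \<Rightarrow> 'a" assume "range y \<subseteq> topspace (subtopology X K)"
    then have y: "range y \<subseteq> K" by auto
    then obtain r z where r: "strict_mono r" and z: "limitin M (s \<circ> y \<circ> r) z sequentially"
      using lift[OF K] by blast
    have "f \<circ> (s \<circ> y \<circ> r) = y \<circ> r"
      using y s compactin_subset_topspace[OF K] by fastforce
    then have lim: "limitin X (y \<circ> r) (f z) sequentially"
      using continuous_map_limit[OF contf z] by simp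
    have "f z \<in> K"
      using y by (intro limitin_closedin[OF lim compactin_imp_closedin[OF X K] always_eventually]) auto
    moreover have "(y \<circ> r) n \<in> K" for n using y by auto
    ultimately have "limitin (subtopology X K) (y \<circ> r) (f z) sequentially"
      using lim unfolding limitin_subtopology by simp
    with r show "\<exists>r l. strict_mono r \<and> limitin (subtopology X K) (y \<circ> r) l sequentially" by blast
  qed
  moreover have "cs_star_continuous X M s"
    unfolding cs_star_continuous_def
  proof (intro conjI allI impI)
    show "s \<in> topspace X \<rightarrow> topspace M" using s Z by blast
    fix y l assume y: "range y \<subseteq> topspace X \<and> limitin X y l sequentially"
    then have "compactin X (insert l (range y))"
      using compactin_sequence_with_limit[of X y l "range y"] by blast
    then obtain r z where r: "strict_mono r" and z: "z \<in> topspace M"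
      and lim: "limitin M (s \<circ> y \<circ> r) z sequentially"
      using lift[of "insert l (range y)" y] by blast
    have "infinite {n. s (y n) \<in> U}" if "openin M U" "z \<in> U" for U
    proof -
      have "\<forall>\<^sub>F n in sequentially. (s \<circ> y \<circ> r) n \<in> U"
        using lim that by (simp add: limitin_def)
      then obtain N where "\<And>n. n \<ge> N \<Longrightarrow> s (y (r n)) \<in> U"
        by (auto simp: eventually_sequentially)
      then have "r ` {N..} \<subseteq> {n. s (y n) \<in> U}" by auto
      moreover have "infinite (r ` {N..})"
        using r by (simp add: finite_image_iff infinite_Ici strict_mono_on_imp_inj_on strict_mono_imp_inj_on inj_on_subset)
      ultimately show ?thesis using finite_subset by blast
    qed
    with z show "\<exists>x\<in>topspace M. \<forall>U. openin M U \<and> x \<in> U \<longrightarrow> infinite {n. s (y n) \<in> U}" by blast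
  qed
  moreover have "section_of M X f s" using s Z by (auto simp: section_of_def)
  ultimately show ?thesis using M contf unfolding cs_star_metrizable_def by blast
qed

text \<open>
  The lifted sequence accumulates somewhere by assumption; that the accumulation point lies
  over the limit \<open>l\<close> comes from continuity of \<open>p\<close> and uniqueness of limits in \<open>X\<close>.
\<close>

lemma cs_star_continuous_section_lift:
  assumes X: "Hausdorff_space X" and M: "metrizable_space M" and p: "continuous_map M X p"
    and s: "section_of M X p s" and cs: "cs_star_continuous X M s"
    and y: "range y \<subseteq> topspace X" "limitin X y l sequentially"
  obtains r z where "strict_mono (r :: nat \<Rightarrow> nat)" "z \<in> topspace M"
    "limitin M (s \<circ> y \<circ> r) z sequentially" "p z = l"
proof -
  obtain z where z: "z \<in> topspace M" "\<And>U. \<lbrakk>openin M U; z \<in> U\<rbrakk> \<Longrightarrow> infinite {n. (s \<circ> y) n \<in> U}"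
    using cs y unfolding cs_star_continuous_def o_def by meson
  then obtain r where r: "strict_mono r" "limitin M (s \<circ> y \<circ> r) z sequentially"
    using metrizable_space_accumulation_subsequence[OF M] by blast
  have "p \<circ> (s \<circ> y \<circ> r) = y \<circ> r"
    using y s unfolding section_of_def by fastforce
  then have "limitin X (y \<circ> r) (p z) sequentially"
    using continuous_map_limit[OF p r(2)] by simp
  moreover have "limitin X (y \<circ> r) l sequentially" using r y by (simp add: limitin_subsequence)
  ultimately have "p z = l" by (rule limitin_Hausdorff_unique) (use X in auto)
  with r z that show thesis by blast
qed

theorem cs_star_metrizable_imp_sigma_cs_finite_network:
  assumes X: "Hausdorff_space X" and "cs_star_metrizable X"
  shows "\<exists>\<N>. sigma_cs_finite X \<N> \<and> cl1osed_cs_star_network X \<N>"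
proof -
  obtain M :: "(nat \<Rightarrow> 'a set) topology" and p s where M: "metrizable_space M"
    and p: "continuous_map M X p" and s: "section_of M X p s" and cs: "cs_star_continuous X M s"
    using assms unfolding cs_star_metrizable_def by blast
  note lift = cs_star_continuous_section_lift[OF X M p s cs]
  have sM: "s y \<in> topspace M" if "y \<in> topspace X" for y using s that by (auto simp: section_of_def)
  obtain \<B> :: "nat \<Rightarrow> (nat \<Rightarrow> 'a set) set set" where lf: "\<And>n. locally_finite_in M (\<B> n)"
    and op: "\<And>n B. B \<in> \<B> n \<Longrightarrow> openin M B"
    and base: "\<And>U x. \<lbrakk>openin M U; x \<in> U\<rbrakk> \<Longrightarrow> \<exists>n. \<exists>B\<in>\<B> n. x \<in> B \<and> B \<subseteq> U"
    using metrizable_space_sigma_locally_finite_base[OF M] by blast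
  define T where "T B = {y \<in> topspace X. s y \<in> B}" for B
  \<comment> \<open>For \<open>y n \<longlonglongrightarrow> l\<close> with \<open>s (y n) \<in> B\<close>, a subsequence of the lifts converges to a point of the closure over \<open>l\<close>.\<close>
  have clT: "cl1 X (T B) \<subseteq> p ` (M closure_of B)" for B
  proof
    fix l assume "l \<in> cl1 X (T B)"
    then obtain y where y: "range y \<subseteq> T B" "limitin X y l sequentially" by (auto simp: cl1_def)
    then have "range y \<subseteq> topspace X" by (auto simp: T_def)
    then obtain r z where "limitin M (s \<circ> y \<circ> r) z sequentially" "p z = l"
      using lift y by metis
    moreover have "(s \<circ> y \<circ> r) n \<in> B \<inter> topspace M" for n using y sM by (auto simp: T_def)
    ultimately have "z \<in> M closure_of B"
      unfolding limitin_sequentially in_closure_of by (metis IntD1 order_refl)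
    with \<open>p z = l\<close> show "l \<in> p ` (M closure_of B)" by blast
  qed
  have csf: "cs_finite X (T ` \<B> n)" for n
    unfolding cs_finite_def
  proof (intro allI impI)
    fix y l assume y: "range y \<subseteq> topspace X \<and> limitin X y l sequentially"
    define \<C> where "\<C> = {B \<in> \<B> n. \<exists>i. s (y i) \<in> B}"
    have "finite \<C>"
    proof (rule ccontr)
      assume inf: "infinite \<C>"
      obtain i where i: "\<And>B. B \<in> \<C> \<Longrightarrow> s (y (i B)) \<in> B"
        using bchoice[of \<C> "\<lambda>B i. s (y i) \<in> B"] unfolding \<C>_def by blast
      \<comment> \<open>The family is point-finite, so the infinitely many sets are met at infinitely many indices.\<close>
      have "infinite (i ` \<C>)"
      proof
        assume "finite (i ` \<C>)"
        then obtain k where k: "infinite {B \<in> \<C>. i B = k}"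
          using inf pigeonhole_infinite[of \<C> i] by auto
        obtain V where "openin M V" "s (y k) \<in> V" and V: "finite {B \<in> \<B> n. B \<inter> V \<noteq> {}}"
          using lf[of n] sM[of "y k"] y unfolding locally_finite_in_def by blast
        then have "{B \<in> \<C>. i B = k} \<subseteq> {B \<in> \<B> n. B \<inter> V \<noteq> {}}" using i by (auto simp: \<C>_def)
        with k V show False using finite_subset by blast
      qed
      then obtain j :: "nat \<Rightarrow> nat" where j: "strict_mono j" "\<And>k. j k \<in> i ` \<C>"
        using infinite_enumerate by blast
      have "range (y \<circ> j) \<subseteq> topspace X" "limitin X (y \<circ> j) l sequentially"
        using y j by (auto simp: limitin_subsequence)
      then obtain r z where r: "strict_mono r" and z: "z \<in> topspace M"
        and lim: "limitin M (s \<circ> (y \<circ> j) \<circ> r) z sequentially"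
        using lift by metis
      \<comment> \<open>Near the limit of the lifts only finitely many members are left to be met.\<close>
      obtain V where V: "openin M V" "z \<in> V" "finite {B \<in> \<B> n. B \<inter> V \<noteq> {}}"
        using lf[of n] z unfolding locally_finite_in_def by blast
      obtain N where N: "\<And>k. k \<ge> N \<Longrightarrow> s (y (j (r k))) \<in> V"
        using lim V unfolding limitin_sequentially by auto
      have "j (r k) \<in> i ` {B \<in> \<B> n. B \<inter> V \<noteq> {}}" if k: "k \<ge> N" for k
      proof -
        obtain B where B: "B \<in> \<C>" "j (r k) = i B" using j(2) by blast
        then have "s (y (j (r k))) \<in> B \<inter> V" using N[OF k] i by auto
        with B show ?thesis by (auto simp: \<C>_def)
      qed
      then have "(j \<circ> r) ` {N..} \<subseteq> i ` {B \<in> \<B> n. B \<inter> V \<noteq> {}}" by auto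
      then have "finite ((j \<circ> r) ` {N..})" using V finite_subset by blast
      moreover have "inj_on (j \<circ> r) {N..}"
        using strict_mono_o[OF j(1) r] by (meson inj_on_subset strict_mono_imp_inj_on subset_UNIV)
      ultimately show False using finite_imageD infinite_Ici by blast
    qed
    moreover have "{A \<in> T ` \<B> n. A \<inter> range y \<noteq> {}} \<subseteq> T ` \<C>"
      by (auto simp: T_def \<C>_def)
    ultimately show "finite {A \<in> T ` \<B> n. A \<inter> range y \<noteq> {}}"
      by (meson finite_imageI finite_subset)
  qed
  define \<N> where "\<N> = (\<Union>n. T ` \<B> n)"
  have "cl1osed_cs_star_network X \<N>"
    unfolding cl1osed_cs_star_network_def
  proof (intro conjI allI impI)
    show "\<forall>N\<in>\<N>. N \<subseteq> topspace X" by (auto simp: \<N>_def T_def)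
    fix U x l assume U: "openin X U \<and> range x \<subseteq> U \<and> l \<in> U \<and> limitin X x l sequentially"
    then have x: "range x \<subseteq> topspace X" using openin_subset by blast
    then obtain r z where r: "strict_mono r" and z: "z \<in> topspace M" "p z = l"
      and lim: "limitin M (s \<circ> x \<circ> r) z sequentially"
      using lift U by metis
    define W where "W = {w \<in> topspace M. p w \<in> U}"
    have "openin M W" "z \<in> W" using p U z by (auto simp: W_def continuous_map_def)
    \<comment> \<open>Regularity keeps the closure of a basic set over \<open>U\<close>, as the bound on \<open>cl1\<close> requires.\<close>
    then obtain V C where V: "openin M V" "z \<in> V" "V \<subseteq> C" "closedin M C" "C \<subseteq> W"
      using metrizable_imp_regular_space[OF M]
      unfolding neighbourhood_base_of_closedin[symmetric] neighbourhood_base_of by metis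
    then obtain n B where B: "B \<in> \<B> n" "z \<in> B" "B \<subseteq> V" using base by blast
    have "M closure_of B \<subseteq> C" using B V by (intro closure_of_minimal) auto
    then have "p ` (M closure_of B) \<subseteq> U" using V by (auto simp: W_def)
    then have "cl1 X (T B) \<subseteq> U" using clT[of B] by (rule order_trans[rotated])
    moreover have "infinite {n. x n \<in> T B}"
    proof -
      obtain N where N: "\<And>k. k \<ge> N \<Longrightarrow> s (x (r k)) \<in> B"
        using lim[unfolded limitin_sequentially, THEN conjunct2, rule_format, of B] op[OF B(1)] B(2)
        by auto
      then have "r ` {N..} \<subseteq> {n. x n \<in> T B}" using x by (auto simp: T_def)
      moreover have "inj_on r {N..}"
        using r by (meson inj_on_subset strict_mono_imp_inj_on subset_UNIV)
      ultimately show ?thesis using finite_imageD finite_subset infinite_Ici by metis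
    qed
    ultimately show "\<exists>N\<in>\<N>. infinite {n. x n \<in> N} \<and> cl1 X N \<subseteq> U"
      using B by (auto simp: \<N>_def)
  qed
  moreover have "sigma_cs_finite X \<N>"
    unfolding sigma_cs_finite_def using csf by (intro exI[of _ "\<lambda>n. T ` \<B> n"]) (simp add: \<N>_def)
  ultimately show ?thesis by blast
qed

section \<open>From sequences to compact sets\<close>

lemma cs_finite_imp_compact_finite:
  assumes sc: "\<And>K. compactin X K \<Longrightarrow> sequentially_compact_space (subtopology X K)"
    and A: "cs_finite X \<A>"
  shows "compact_finite X \<A>"
  unfolding compact_finite_def
proof (intro allI impI, rule ccontr)
  fix K assume K: "compactin X K" and inf: "infinite {A \<in> \<A>. A \<inter> K \<noteq> {}}"
  obtain F :: "nat \<Rightarrow> 'a set" where F: "inj F" "range F \<subseteq> {A \<in> \<A>. A \<inter> K \<noteq> {}}"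
    using infinite_countable_subset[OF inf] by blast
  then have "\<forall>n. \<exists>x. x \<in> F n \<inter> K" by blast
  then obtain x where x: "\<And>n. x n \<in> F n \<inter> K" by metis
  then have "range x \<subseteq> topspace (subtopology X K)" using compactin_subset_topspace[OF K] by auto
  then obtain r l where r: "strict_mono (r :: nat \<Rightarrow> nat)"
    and lim: "limitin (subtopology X K) (x \<circ> r) l sequentially"
    using sc[OF K] unfolding sequentially_compact_space_def by blast
  have "limitin X (x \<circ> r) l sequentially" "range (x \<circ> r) \<subseteq> topspace X"
    using lim x compactin_subset_topspace[OF K] by (auto simp: limitin_subtopology)
  then have "finite {A \<in> \<A>. A \<inter> range (x \<circ> r) \<noteq> {}}"
    using A unfolding cs_finite_def by blast
  moreover have "range (F \<circ> r) \<subseteq> {A \<in> \<A>. A \<inter> range (x \<circ> r) \<noteq> {}}"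
    using F x by fastforce
  ultimately have "finite (range (F \<circ> r))" using finite_subset by blast
  moreover have "inj (F \<circ> r)" using F r by (simp add: inj_compose strict_mono_imp_inj_on)
  ultimately show False using finite_imageD infinite_UNIV_nat by blast
qed

theorem cs_star_network_imp_k_network:
  assumes sc: "\<And>K. compactin X K \<Longrightarrow> sequentially_compact_space (subtopology X K)"
    and \<sigma>: "sigma_cs_finite X \<N>" and N: "cl1osed_cs_star_network X \<N>"
  shows "sigma_compact_finite X \<N> \<and> cl1osed_k_network X \<N>"
proof
  obtain \<B> :: "nat \<Rightarrow> 'a set set" where \<B>: "\<N> = (\<Union>n. \<B> n)" and cf: "\<And>n. compact_finite X (\<B> n)"
    using \<sigma> cs_finite_imp_compact_finite[OF sc] unfolding sigma_cs_finite_def by metis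
  then show "sigma_compact_finite X \<N>" unfolding sigma_compact_finite_def by blast
  show "cl1osed_k_network X \<N>"
    unfolding cl1osed_k_network_def
  proof (intro conjI allI impI)
    show top: "\<forall>N\<in>\<N>. N \<subseteq> topspace X" using N by (simp add: cl1osed_cs_star_network_def)
    fix U K assume UK: "openin X U \<and> compactin X K \<and> K \<subseteq> U"
    then have K: "compactin X K" and KX: "K \<subseteq> topspace X" by (auto simp: compactin_subset_topspace)
    define \<F> where "\<F> n = {A \<in> \<Union>(\<B> ` {..n}). A \<inter> K \<noteq> {} \<and> cl1 X A \<subseteq> U}" for n
    have fin: "finite (\<F> n)" for n
    proof -
      have "finite (\<Union>k\<in>{..n}. {A \<in> \<B> k. A \<inter> K \<noteq> {}})"
        using cf K by (auto simp: compact_finite_def)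
      moreover have "\<F> n \<subseteq> (\<Union>k\<in>{..n}. {A \<in> \<B> k. A \<inter> K \<noteq> {}})" by (auto simp: \<F>_def)
      ultimately show ?thesis by (rule rev_finite_subset)
    qed
    have sub: "\<F> n \<subseteq> \<N>" for n by (auto simp: \<F>_def \<B>)
    \<comment> \<open>The finite subfamilies \<open>\<F> n\<close> increase to all admissible members, so one of them must cover \<open>K\<close>.\<close>
    have "\<exists>n. K \<subseteq> \<Union>(\<F> n)"
    proof (rule ccontr)
      assume "\<nexists>n. K \<subseteq> \<Union>(\<F> n)"
      then have "\<forall>n. \<exists>x. x \<in> K \<and> x \<notin> \<Union>(\<F> n)" by blast
      then obtain x where x: "\<And>n. x n \<in> K \<and> x n \<notin> \<Union>(\<F> n)" by metis
      then have "range x \<subseteq> topspace (subtopology X K)" using KX by auto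
      then obtain r l where r: "strict_mono (r :: nat \<Rightarrow> nat)"
        and "limitin (subtopology X K) (x \<circ> r) l sequentially"
        using sc[OF K] unfolding sequentially_compact_space_def by blast
      then have l: "l \<in> K" "limitin X (x \<circ> r) l sequentially" by (auto simp: limitin_subtopology)
      then have "l \<in> U" "range (x \<circ> r) \<subseteq> U" using UK x by auto
      then obtain A where A: "A \<in> \<N>" "infinite {n. (x \<circ> r) n \<in> A}" "cl1 X A \<subseteq> U"
        using N UK l unfolding cl1osed_cs_star_network_def by blast
      obtain m where m: "A \<in> \<B> m" using A \<B> by blast
      obtain k where k: "k \<ge> m" "x (r k) \<in> A"
        using A(2) unfolding infinite_nat_iff_unbounded_le by auto
      have "m \<le> r k" using k(1) strict_mono_imp_increasing[OF r, of k] by linarith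
      then have "A \<in> \<F> (r k)" using A m k x by (auto simp: \<F>_def)
      with x k show False by blast
    qed
    then obtain n where n: "K \<subseteq> \<Union>(\<F> n)" by blast
    have "cl1 X (\<Union>(\<F> n)) \<subseteq> U" using cl1_Union_finite[OF fin, of X n] by (auto simp: \<F>_def)
    moreover have "\<Union>(\<F> n) \<subseteq> cl1 X (\<Union>(\<F> n))" using top sub by (intro subset_cl1) blast
    ultimately show "\<exists>\<F>. finite \<F> \<and> \<F> \<subseteq> \<N> \<and> K \<subseteq> \<Union>\<F> \<and> \<Union>\<F> \<subseteq> cl1 X (\<Union>\<F>) \<and> cl1 X (\<Union>\<F>) \<subseteq> U"
      using fin sub n by (intro exI[of _ "\<F> n"]) simp
  qed
qed

section \<open>The section of the Network Hyperspace\<close>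

text \<open>
  A Hausdorff space need not be regular, but its compact subspaces are; this is the amount of
  regularity needed to pass from a point of \<open>K\<close> to a compact piece of \<open>K\<close>, to which a
  \<open>k\<close>-network applies.
\<close>

lemma compactin_neighbourhood_shrink:
  assumes X: "Hausdorff_space X" and K: "compactin X K" and V: "openin X V" "x \<in> K" "x \<in> V"
  obtains W L where "openin X W" "x \<in> W" "compactin X L" "K \<inter> W \<subseteq> L" "L \<subseteq> V"
proof -
  have "regular_space (subtopology X K)"
    using X K by (intro compact_Hausdorff_imp_regular_space)
      (auto simp: compact_space_subtopology Hausdorff_space_subtopology)
  moreover have "openin (subtopology X K) (K \<inter> V)" "x \<in> K \<inter> V"
    using V by (auto simp: openin_subtopology_Int2)
  ultimately obtain W' L where W': "openin (subtopology X K) W'" "closedin (subtopology X K) L"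
      "x \<in> W'" "W' \<subseteq> L" "L \<subseteq> K \<inter> V"
    unfolding neighbourhood_base_of_closedin[symmetric] neighbourhood_base_of by metis
  obtain W where W: "openin X W" "W' = W \<inter> K" using W'(1) by (auto simp: openin_subtopology)
  have "closedin X L"
    using W'(2) compactin_imp_closedin[OF X K] closedin_closed_subtopology by blast
  then have "compactin X L" using W'(5) K closed_compactin by blast
  with that[of W L] W W' show thesis by blast
qed

text \<open>
  It is essential that \<open>s\<close> is controlled uniformly on compact sets: for a compact \<open>L \<subseteq> U\<close> a single
  index \<open>m\<close> gives \<open>cl1 X (s x m) \<subseteq> U\<close> for all \<open>x\<close> in \<open>L\<close>, namely as soon as \<open>\<B> 0, \<dots>, \<B> m\<close> contain a
  finite subfamily covering \<open>L\<close> as in the definition of a network. For \<open>L = {x}\<close> this says that \<open>s x\<close>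
  is a network at \<open>x\<close>; for general \<open>L\<close> it lets the property survive passage to the closure
  of \<open>s ` L\<close>.
\<close>

theorem k_network_imp_Nw_section:
  assumes X: "Hausdorff_space X" and \<sigma>: "sigma_compact_finite X \<N>" and N: "cl1osed_k_network X \<N>"
  shows "\<exists>s. section_of (Nw_space X) X (Nw_lim X) s \<and> preserves_precompact X (Nw_space X) s"
proof -
  obtain \<B> :: "nat \<Rightarrow> 'a set set" where \<B>: "\<N> = (\<Union>n. \<B> n)" and cf: "\<And>n. compact_finite X (\<B> n)"
    using \<sigma> unfolding sigma_compact_finite_def by blast
  define \<F> where "\<F> n K = {A \<in> \<Union>(\<B> ` {..n}). A \<inter> K \<noteq> {}}" for n K
  have fin: "finite (\<F> n K)" if "compactin X K" for n K
  proof -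
    have "finite (\<Union>k\<in>{..n}. {A \<in> \<B> k. A \<inter> K \<noteq> {}})"
      using cf that by (auto simp: compact_finite_def)
    moreover have "\<F> n K = (\<Union>k\<in>{..n}. {A \<in> \<B> k. A \<inter> K \<noteq> {}})" by (auto simp: \<F>_def)
    ultimately show ?thesis by simp
  qed
  \<comment> \<open>Intersecting with the space gives a meaning to the empty intersection.\<close>
  define s where "s x n = topspace X \<inter> \<Inter>(\<F> n {x})" for x n
  have s_sub: "s x n \<subseteq> topspace X" for x n by (auto simp: s_def)
  have s_mem: "x \<in> s x n" if "x \<in> topspace X" for x n using that by (auto simp: s_def \<F>_def)
  have s_dec: "s x n \<subseteq> s x m" if "m \<le> n" for x m n
  proof -
    have "\<Union>(\<B> ` {..m}) \<subseteq> \<Union>(\<B> ` {..n})" using that by (intro UN_mono) auto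
    then have "\<F> m {x} \<subseteq> \<F> n {x}" unfolding \<F>_def by (intro Collect_mono) blast
    then show ?thesis unfolding s_def by blast
  qed
  have key: "\<exists>m. \<forall>x\<in>L. \<forall>n\<ge>m. cl1 X (s x n) \<subseteq> U" if UL: "openin X U" "compactin X L" "L \<subseteq> U" for U L
  proof -
    obtain \<G> where \<G>: "finite \<G>" "\<G> \<subseteq> \<N>" "L \<subseteq> \<Union>\<G>" "cl1 X (\<Union>\<G>) \<subseteq> U"
      using cl1osed_k_networkD[OF N UL] by metis
    have "\<forall>A\<in>\<G>. \<exists>k. A \<in> \<B> k" using \<G> \<B> by blast
    then obtain k where k: "\<And>A. A \<in> \<G> \<Longrightarrow> A \<in> \<B> (k A)" by metis
    obtain m where m: "\<And>A. A \<in> \<G> \<Longrightarrow> k A \<le> m"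
      using finite_nat_set_iff_bounded_le[of "k ` \<G>"] \<G>(1) by auto
    have "cl1 X (s x n) \<subseteq> U" if x: "x \<in> L" and n: "n \<ge> m" for x n
    proof -
      obtain A where A: "A \<in> \<G>" "x \<in> A" using x \<G> by blast
      then have "k A \<le> n" using m n le_trans by blast
      then have "A \<in> \<F> n {x}" using A k by (auto simp: \<F>_def)
      then have "s x n \<subseteq> \<Union>\<G>" using A by (auto simp: s_def)
      then show ?thesis using cl1_mono \<G>(4) by blast
    qed
    then show ?thesis by blast
  qed
  have s_Nw: "s x \<in> Nw X x" if x: "x \<in> topspace X" for x
  proof -
    have "\<exists>n. cl1 X (s x n) \<subseteq> U" if "openin X U" "x \<in> U" for U
      using key[of U "{x}"] that x by auto
    moreover have "s x n \<noteq> {}" for n using s_mem[OF x] by blast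
    moreover have "s x (Suc n) \<subseteq> s x n" for n by (rule s_dec) simp
    ultimately show ?thesis unfolding Nw_def by (simp add: s_sub)
  qed
  have sect: "section_of (Nw_space X) X (Nw_lim X) s"
    unfolding section_of_def topspace_Nw_space using s_Nw Nw_lim_eq[OF X] by auto
  have "precompactin (Nw_space X) (s ` K)" if "precompactin X K" for K
  proof -
    define L where "L = X closure_of K"
    have L: "compactin X L" and KL: "K \<subseteq> L" and KX: "K \<subseteq> topspace X"
      using that closure_of_subset unfolding precompactin_def L_def by auto
    have LX: "L \<subseteq> topspace X" using L compactin_subset_topspace by blast
    let ?P = "product_topology (\<lambda>_::nat. discrete_topology (Pow (topspace X))) UNIV"
    define Q where "Q n = (\<lambda>x. s x n) ` L" for n
    have finQ: "finite (Q n)" for n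
    proof -
      have "Q n \<subseteq> (\<lambda>\<G>. topspace X \<inter> \<Inter>\<G>) ` Pow (\<F> n L)"
        by (auto simp: Q_def s_def \<F>_def)
      then show ?thesis using fin[OF L] by (meson finite_Pow_iff finite_imageI finite_subset)
    qed
    have compQ: "compactin ?P (PiE UNIV Q)"
      using finQ s_sub by (auto simp: compactin_PiE compactin_discrete_topology Q_def)
    have sQ: "s ` L \<subseteq> PiE UNIV Q" by (auto simp: Q_def PiE_iff)
    have closedQ: "closedin ?P (PiE UNIV Q)"
      by (intro compactin_imp_closedin compQ)
        (simp add: Hausdorff_space_product_topology Hausdorff_space_discrete_topology)
    have clQ: "?P closure_of (s ` L) \<subseteq> PiE UNIV Q"
      using sQ closedQ by (rule closure_of_minimal)
    have comp: "compactin ?P (?P closure_of (s ` L))"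
      using compQ clQ closed_compactin closedin_closure_of by blast
    have "?P closure_of (s ` L) \<subseteq> (\<Union>x\<in>topspace X. Nw X x)"
    proof
      fix A assume A: "A \<in> ?P closure_of (s ` L)"
      \<comment> \<open>Neighbourhoods in a power of a discrete space fix finitely many coordinates.\<close>
      have "\<exists>x\<in>L. \<forall>k\<le>n. s x k = A k" for n
      proof -
        define G where "G = PiE UNIV (\<lambda>k. if k \<le> n then {A k} else Pow (topspace X))"
        have top: "A \<in> topspace ?P" using A by (meson closure_of_subset_topspace subsetD)
        have "openin ?P G"
          unfolding G_def openin_PiE_gen using top
          by (auto simp: PiE_iff intro!: disjI2 rev_finite_subset[of "{..n}"])
        moreover have "A \<in> G" using top by (auto simp: G_def PiE_iff)
        ultimately obtain x where "x \<in> L" "s x \<in> G" using A by (auto simp: in_closure_of)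
        have "s x k = A k" if "k \<le> n" for k
          using \<open>s x \<in> G\<close>[unfolded G_def, THEN PiE_mem, of k] that by simp
        with \<open>x \<in> L\<close> show ?thesis by blast
      qed
      then obtain x where x: "\<And>n. x n \<in> L" "\<And>n k. k \<le> n \<Longrightarrow> s (x n) k = A k" by metis
      have xX: "x n \<in> topspace X" for n using x LX by blast
      \<comment> \<open>The sequence \<open>A\<close> will be a network at any accumulation point of the approximating points.\<close>
      obtain l where l: "l \<in> L" "\<And>U. \<lbrakk>openin X U; l \<in> U\<rbrakk> \<Longrightarrow> infinite {n. x n \<in> U}"
        using compactin_imp_accumulation_point[where \<sigma> = x, OF L x(1)] by metis
      have "A \<in> Nw X l"
        unfolding Nw_def
      proof (intro CollectI conjI allI impI)
        fix n
        have An: "A n = s (x (Suc n)) n" "A (Suc n) = s (x (Suc n)) (Suc n)" using x by auto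
        show "A n \<subseteq> topspace X" "A (Suc n) \<subseteq> A n"
          using An s_sub s_dec[of n "Suc n"] by auto
        show "A n \<noteq> {}" using An(1) s_mem[OF xX, of "Suc n" n] by auto
      next
        fix U assume U: "openin X U \<and> l \<in> U"
        then obtain W C where W: "openin X W" "l \<in> W" "compactin X C" "L \<inter> W \<subseteq> C" "C \<subseteq> U"
          using compactin_neighbourhood_shrink[OF X L _ l(1)] by metis
        \<comment> \<open>The index \<open>m\<close> depends only on \<open>C\<close>, so it serves every \<open>x n\<close> that lies in \<open>C\<close>.\<close>
        obtain m where m: "\<And>y n. \<lbrakk>y \<in> C; n \<ge> m\<rbrakk> \<Longrightarrow> cl1 X (s y n) \<subseteq> U"
          using key[of U C] U W by blast
        obtain n where n: "n \<ge> m" "x n \<in> W"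
          using l(2)[OF W(1,2)] unfolding infinite_nat_iff_unbounded_le by auto
        then have "x n \<in> C" using x W by blast
        then have "cl1 X (A m) \<subseteq> U" using m[of "x n" m] x(2)[OF n(1)] by simp
        then show "\<exists>n. cl1 X (A n) \<subseteq> U" by blast
      qed
      then show "A \<in> (\<Union>x\<in>topspace X. Nw X x)" using l LX by blast
    qed
    with comp have "compactin (Nw_space X) (?P closure_of (s ` L))"
      unfolding Nw_space_def compactin_subtopology by blast
    moreover have "(Nw_space X) closure_of (s ` K) \<subseteq> ?P closure_of (s ` L)"
      using closure_of_subtopology_subset[of ?P _ "s ` K"] closure_of_mono[of "s ` K" "s ` L" ?P] KL
      unfolding Nw_space_def by blast
    ultimately have "compactin (Nw_space X) ((Nw_space X) closure_of (s ` K))"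
      using closed_compactin closedin_closure_of by blast
    moreover have "s ` K \<subseteq> topspace (Nw_space X)"
      using s_Nw KX unfolding topspace_Nw_space by blast
    ultimately show ?thesis by (simp add: precompactin_def)
  qed
  with sect show ?thesis unfolding preserves_precompact_def by blast
qed

lemma metrizable_space_Nw_space: "metrizable_space (Nw_space X)"
  unfolding Nw_space_def
  by (intro metrizable_space_subtopology) (simp add: metrizable_space_product_topology)

text \<open>
  Any choice of points \<open>a k \<in> A (k + n)\<close> converges to the point at which \<open>A\<close> is a network. Hence the
  single set \<open>A n\<close> already confines the value of the limit map, whence its continuity below.
\<close>

lemma Nw_point_in_cl1:
  assumes A: "A \<in> Nw X x" and x: "x \<in> topspace X"
  shows "x \<in> cl1 X (A n)"
proof -
  have dec: "decseq A" and ne: "\<And>k. A k \<noteq> {}" and sub: "\<And>k. A k \<subseteq> topspace X"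
    using A by (auto simp: Nw_def decseq_Suc_iff)
  have "\<forall>k. \<exists>a. a \<in> A (k + n)" using ne by blast
  then obtain a where a: "\<And>k. a k \<in> A (k + n)" by metis
  have "limitin X a x sequentially"
    unfolding limitin_sequentially
  proof (intro conjI allI impI x)
    fix U assume "openin X U \<and> x \<in> U"
    then obtain m where "cl1 X (A m) \<subseteq> U" using A by (auto simp: Nw_def)
    then have "A m \<subseteq> U" using subset_cl1[OF sub] by blast
    then have "a k \<in> U" if "m \<le> k" for k
      using a[of k] decseqD[OF dec, of m "k + n"] that by auto
    then show "\<exists>N. \<forall>k. N \<le> k \<longrightarrow> a k \<in> U" by blast
  qed
  moreover have "a k \<in> A n" for k using a[of k] decseqD[OF dec, of n "k + n"] by auto
  ultimately show ?thesis unfolding cl1_def by blast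
qed

lemma continuous_map_Nw_lim:
  assumes X: "Hausdorff_space X"
  shows "continuous_map (Nw_space X) X (Nw_lim X)"
  unfolding continuous_map
proof (intro conjI allI impI)
  let ?P = "product_topology (\<lambda>_::nat. discrete_topology (Pow (topspace X))) UNIV"
  show "Nw_lim X ` topspace (Nw_space X) \<subseteq> topspace X"
    unfolding topspace_Nw_space using Nw_lim_eq[OF X] by auto
  fix U assume U: "openin X U"
  show "openin (Nw_space X) {A \<in> topspace (Nw_space X). Nw_lim X A \<in> U}"
  proof (subst openin_subopen, intro ballI)
    fix A assume "A \<in> {A \<in> topspace (Nw_space X). Nw_lim X A \<in> U}"
    then obtain x where x: "x \<in> topspace X" "A \<in> Nw X x" "x \<in> U"
      unfolding topspace_Nw_space using Nw_lim_eq[OF X] by auto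
    then obtain n where n: "cl1 X (A n) \<subseteq> U" using U by (auto simp: Nw_def)
    define G where "G = {B \<in> topspace (Nw_space X). B n \<in> {A n}}"
    have "continuous_map (Nw_space X) (discrete_topology (Pow (topspace X))) (\<lambda>B. B n)"
      unfolding Nw_space_def
      by (intro continuous_map_from_subtopology continuous_map_product_projection) simp
    moreover have "openin (discrete_topology (Pow (topspace X))) {A n}"
      using x by (auto simp: Nw_def)
    ultimately have "openin (Nw_space X) G"
      unfolding G_def by (rule openin_continuous_map_preimage)
    moreover have "A \<in> G" using x by (auto simp: G_def topspace_Nw_space)
    moreover have "Nw_lim X B \<in> U" if B: "B \<in> G" for B
    proof -
      obtain y where y: "y \<in> topspace X" "B \<in> Nw X y" using B by (auto simp: G_def topspace_Nw_space)
      then have "y \<in> cl1 X (B n)" by (intro Nw_point_in_cl1)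
      then show ?thesis using B n y Nw_lim_eq[OF X] by (auto simp: G_def)
    qed
    ultimately show "\<exists>T. openin (Nw_space X) T \<and> A \<in> T \<and>
        T \<subseteq> {A \<in> topspace (Nw_space X). Nw_lim X A \<in> U}"
      by (intro exI[of _ G]) (auto simp: G_def)
  qed
qed

theorem Nw_section_imp_k_star_metrizable:
  assumes X: "Hausdorff_space X" and s: "section_of (Nw_space X) X (Nw_lim X) s"
    and pre: "preserves_precompact X (Nw_space X) s"
  shows "k_star_metrizable X"
proof -
  have "subproper_map (Nw_space X) X (Nw_lim X)"
    unfolding subproper_map_def
  proof (intro conjI exI allI impI)
    show "continuous_map (Nw_space X) X (Nw_lim X)" by (rule continuous_map_Nw_lim[OF X])
    show "s ` topspace X \<subseteq> topspace (Nw_space X)" using s by (auto simp: section_of_def)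
    show "Nw_lim X ` s ` topspace X = topspace X" using s by (force simp: section_of_def)
    fix K assume K: "precompactin X K"
    then have "s ` topspace X \<inter> Nw_lim X -` K = s ` K"
      using s by (auto simp: section_of_def precompactin_def)
    then show "precompactin (Nw_space X) (s ` topspace X \<inter> Nw_lim X -` K)"
      using pre K by (simp add: preserves_precompact_def)
  qed
  then show ?thesis using metrizable_space_Nw_space unfolding k_star_metrizable_def by blast
qed

section \<open>Sequentially regular spaces\<close>

lemma cl1osed_k_network_imp_k_network: "cl1osed_k_network X \<N> \<Longrightarrow> k_network X \<N>"
  unfolding cl1osed_k_network_def k_network_def by (meson order_trans)

text \<open>
  A compact set \<open>K \<subseteq> U\<close> is the union of finitely many compact pieces, each inside an open \<open>V\<close> with
  \<open>cl1 X V \<subseteq> U\<close>. The \<open>k\<close>-network covers each piece inside its own \<open>V\<close>, and \<open>cl1\<close> of a finite union is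
  contained in the union of the \<open>cl1\<close>.
\<close>

lemma sequentially_regular_k_network:
  assumes X: "Hausdorff_space X" and reg: "sequentially_regular X" and N: "k_network X \<N>"
  shows "cl1osed_k_network X \<N>"
  unfolding cl1osed_k_network_def
proof (intro conjI allI impI)
  show top: "\<forall>N\<in>\<N>. N \<subseteq> topspace X" using N by (simp add: k_network_def)
  fix U K assume UK: "openin X U \<and> compactin X K \<and> K \<subseteq> U"
  have "\<exists>W \<F>. openin X W \<and> x \<in> W \<and> finite \<F> \<and> \<F> \<subseteq> \<N> \<and> K \<inter> W \<subseteq> \<Union>\<F> \<and> cl1 X (\<Union>\<F>) \<subseteq> U"
    if x: "x \<in> K" for x
  proof -
    obtain V where V: "openin X V" "x \<in> V" "cl1 X V \<subseteq> U"
      using reg[unfolded sequentially_regular_def, rule_format, of U x] UK x by blast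
    obtain W L where W: "openin X W" "x \<in> W" "compactin X L" "K \<inter> W \<subseteq> L" "L \<subseteq> V"
      using compactin_neighbourhood_shrink[OF X _ V(1) x V(2)] UK by metis
    obtain \<F> where \<F>: "finite \<F>" "\<F> \<subseteq> \<N>" "L \<subseteq> \<Union>\<F>" "\<Union>\<F> \<subseteq> V"
      using k_networkD[OF N V(1) W(3,5)] by metis
    have "cl1 X (\<Union>\<F>) \<subseteq> U" using cl1_mono[OF \<F>(4)] V(3) by (rule order_trans)
    then show ?thesis
      using W \<F> by (intro exI[of _ W] exI[of _ \<F>]) auto
  qed
  then obtain W \<F> where W: "\<And>x. x \<in> K \<Longrightarrow> openin X (W x) \<and> x \<in> W x"
    and \<F>: "\<And>x. x \<in> K \<Longrightarrow> finite (\<F> x) \<and> \<F> x \<subseteq> \<N> \<and> K \<inter> W x \<subseteq> \<Union>(\<F> x) \<and> cl1 X (\<Union>(\<F> x)) \<subseteq> U"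
    by metis
  have "\<exists>\<W>. finite \<W> \<and> \<W> \<subseteq> W ` K \<and> K \<subseteq> \<Union>\<W>"
    using UK W by (intro compactinD) auto
  then obtain F where F: "finite F" "F \<subseteq> K" "K \<subseteq> \<Union>(W ` F)" by (metis finite_subset_image)
  define \<G> where "\<G> = (\<Union>x\<in>F. \<F> x)"
  have \<G>: "finite \<G>" "\<G> \<subseteq> \<N>" using F \<F> unfolding \<G>_def by blast+
  have "K \<subseteq> \<Union>\<G>"
  proof
    fix k assume k: "k \<in> K"
    then obtain x where x: "x \<in> F" "k \<in> W x" using F(3) by blast
    then have "K \<inter> W x \<subseteq> \<Union>(\<F> x)" using F(2) \<F> by blast
    then obtain A where "A \<in> \<F> x" "k \<in> A" using k x by auto
    with x show "k \<in> \<Union>\<G>" unfolding \<G>_def by auto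
  qed
  have "\<Union>\<G> = \<Union>((\<lambda>x. \<Union>(\<F> x)) ` F)" by (auto simp: \<G>_def)
  then have "cl1 X (\<Union>\<G>) \<subseteq> (\<Union>x\<in>F. cl1 X (\<Union>(\<F> x)))"
    using cl1_Union_finite[of "(\<lambda>x. \<Union>(\<F> x)) ` F" X] F(1) by simp
  also have "\<dots> \<subseteq> U"
    by (intro UN_least) (use F(2) \<F> in auto)
  finally have "cl1 X (\<Union>\<G>) \<subseteq> U" .
  moreover have "\<Union>\<G> \<subseteq> cl1 X (\<Union>\<G>)" using top \<G> by (intro subset_cl1) blast
  ultimately show "\<exists>\<F>. finite \<F> \<and> \<F> \<subseteq> \<N> \<and> K \<subseteq> \<Union>\<F> \<and> \<Union>\<F> \<subseteq> cl1 X (\<Union>\<F>) \<and> cl1 X (\<Union>\<F>) \<subseteq> U"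
    using \<G> \<open>K \<subseteq> \<Union>\<G>\<close> by (intro exI[of _ \<G>]) simp
qed

theorem theorem6p4:
  fixes X :: "'a topology"
  assumes "Hausdorff_space X"
  shows
    "(k_star_metrizable X \<longleftrightarrow>
        cs_star_metrizable X \<and>
        (\<forall>K. compactin X K \<longrightarrow> sequentially_compact_space (subtopology X K)))
     \<and>
     (k_star_metrizable X \<longleftrightarrow>
        (\<exists>s. section_of (Nw_space X) X (Nw_lim X) s \<and> preserves_precompact X (Nw_space X) s))
     \<and>
     (k_star_metrizable X \<longleftrightarrow>
        (\<forall>K. compactin X K \<longrightarrow> sequentially_compact_space (subtopology X K)) \<and>
        (\<exists>\<N>. sigma_cs_finite X \<N> \<and> cl1osed_cs_star_network X \<N>))
     \<and>
     (k_star_metrizable X \<longleftrightarrow>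
        (\<exists>\<N>. sigma_compact_finite X \<N> \<and> cl1osed_k_network X \<N>))
     \<and>
     (sequentially_regular X \<longrightarrow>
        (k_star_metrizable X \<longleftrightarrow>
           (\<exists>\<N>. sigma_compact_finite X \<N> \<and> k_network X \<N>)))"
proof -
  let ?seq = "\<forall>K. compactin X K \<longrightarrow> sequentially_compact_space (subtopology X K)"
  let ?k = "\<exists>\<N>. sigma_compact_finite X \<N> \<and> cl1osed_k_network X \<N>"
  have k_cs: "cs_star_metrizable X \<and> ?seq" if "k_star_metrizable X"
    using k_star_metrizable_imp_cs_star_metrizable[OF assms that] .
  have cs_net: "\<exists>\<N>. sigma_cs_finite X \<N> \<and> cl1osed_cs_star_network X \<N>" if "cs_star_metrizable X"
    using cs_star_metrizable_imp_sigma_cs_finite_network[OF assms that] .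
  have net_knet: ?k if "?seq \<and> (\<exists>\<N>. sigma_cs_finite X \<N> \<and> cl1osed_cs_star_network X \<N>)"
    using that cs_star_network_imp_k_network by metis
  have knet_sec: "\<exists>s. section_of (Nw_space X) X (Nw_lim X) s \<and> preserves_precompact X (Nw_space X) s" if ?k
    using that k_network_imp_Nw_section[OF assms] by blast
  have sec_k: "k_star_metrizable X"
    if "\<exists>s. section_of (Nw_space X) X (Nw_lim X) s \<and> preserves_precompact X (Nw_space X) s"
    using that Nw_section_imp_k_star_metrizable[OF assms] by blast
  have knet_iff: "?k \<longleftrightarrow> (\<exists>\<N>. sigma_compact_finite X \<N> \<and> k_network X \<N>)" if "sequentially_regular X"
    using cl1osed_k_network_imp_k_network sequentially_regular_k_network[OF assms that] by blast
  show ?thesis using k_cs cs_net net_knet knet_sec sec_k knet_iff by argo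
qed

end
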